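(* Let $p_0,\dots,p_n\in\mathbb{R}^n$ be affinely independent, let $S$ be the simplex with vertices $p_0,\dots,p_n$, let $\overline{p}=\frac{1}{n+1}\sum_{i=0}^n p_i$ be its barycenter and $\operatorname{vol}(S)$ its volume. Let $\mathcal{T}$ be a positive linear functional defined (at least) on the linear subspace, of the space of all functions mapping $S$ into $\mathbb{R}$, generated by the cone of convex functions. Assume that $$\mathcal{T}(A)=\frac{1}{\operatorname{vol}(S)}\int_S A(x)\,dx$$ for any affine function $A:S\to\mathbb{R}$. Then the inequality $$f(\overline{p})\leq\mathcal{T}(f)\leq\frac{1}{n+1}\sum_{i=0}^n f(p_i)$$ holds for any convex function $f:S\to\mathbb{R}$.
   Context: A linear functional $\mathcal{T}$ defined on a linear space $X$ of (not necessarily all) functions mapping some nonempty set into $\mathbb{R}$ is called positive if, for any $f,g\in X$, $f\leq g$ (pointwise) implies $\mathcal{T}(f)\leq\mathcal{T}(g)$. The simplex $S$ is the convex hull of $\{p_0,\dots,p_n\}$, and $\operatorname{vol}(S)$ is its $n$-dimensional Lebesgue measure. *)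

theory Defs
  imports "HOL-Analysis.Analysis"
begin

text \<open>
  A function \<open>S \<rightarrow> \<real>\<close> is an element of \<^term>\<open>S \<rightarrow>\<^sub>E (UNIV :: real set)\<close>, so that two functions agreeing
  on \<open>S\<close> are equal. The vector space operations therefore have to be restricted to \<open>S\<close> again.
\<close>

definition fun_subspace :: "'a set \<Rightarrow> ('a \<Rightarrow> real) set \<Rightarrow> bool" where
  "fun_subspace S X \<longleftrightarrow>
     X \<subseteq> (S \<rightarrow>\<^sub>E UNIV) \<and>
     (\<lambda>x\<in>S. 0) \<in> X \<and>
     (\<forall>f\<in>X. \<forall>g\<in>X. (\<lambda>x\<in>S. f x + g x) \<in> X) \<and>
     (\<forall>c. \<forall>f\<in>X. (\<lambda>x\<in>S. c * f x) \<in> X)"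

definition fun_span :: "'a set \<Rightarrow> ('a \<Rightarrow> real) set \<Rightarrow> ('a \<Rightarrow> real) set" where
  "fun_span S C = fun_subspace S hull C"

definition linear_functional_on :: "'a set \<Rightarrow> ('a \<Rightarrow> real) set \<Rightarrow> (('a \<Rightarrow> real) \<Rightarrow> real) \<Rightarrow> bool" where
  "linear_functional_on S X T \<longleftrightarrow>
     fun_subspace S X \<and>
     (\<forall>f\<in>X. \<forall>g\<in>X. T (\<lambda>x\<in>S. f x + g x) = T f + T g) \<and>
     (\<forall>c. \<forall>f\<in>X. T (\<lambda>x\<in>S. c * f x) = c * T f)"

definition positive_functional_on :: "'a set \<Rightarrow> ('a \<Rightarrow> real) set \<Rightarrow> (('a \<Rightarrow> real) \<Rightarrow> real) \<Rightarrow> bool" where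
  "positive_functional_on S X T \<longleftrightarrow>
     (\<forall>f\<in>X. \<forall>g\<in>X. (\<forall>x\<in>S. f x \<le> g x) \<longrightarrow> T f \<le> T g)"

definition convex_functions :: "'a::real_vector set \<Rightarrow> ('a \<Rightarrow> real) set" where
  "convex_functions S = {f \<in> S \<rightarrow>\<^sub>E UNIV. convex_on S f}"

text \<open>
  As for \<^const>\<open>convex_on\<close>, the domain is required to be convex. No extension of the function
  to the ambient space is mentioned.
\<close>

definition affine_on :: "'a::real_vector set \<Rightarrow> ('a \<Rightarrow> real) \<Rightarrow> bool" where
  "affine_on S A \<longleftrightarrow> convex S \<and>
     (\<forall>x\<in>S. \<forall>y\<in>S. \<forall>u\<ge>0. \<forall>v\<ge>0. u + v = 1 \<longrightarrow>
        A (u *\<^sub>R x + v *\<^sub>R y) = u * A x + v * A y)"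

definition affine_functions :: "'a::real_vector set \<Rightarrow> ('a \<Rightarrow> real) set" where
  "affine_functions S = {A \<in> S \<rightarrow>\<^sub>E UNIV. affine_on S A}"

end

theory Submission
  imports Defs "HOL-Probability.Distribution_Functions"
begin

text \<open>
  The homothety with centre \<open>a\<close> and ratio \<open>s\<close> maps the simplex onto the part where the barycentric
  coordinate of \<open>a\<close> is at least \<open>1 - s\<close>. Hence all barycentric coordinates have the same distribution
  under Lebesgue measure on the simplex; they sum to 1, so each has mean \<open>1 / (n + 1)\<close>, and \<open>T A\<close>
  is the value at the barycenter for every affine \<open>A\<close>. A convex function lies above a supporting
  affine function at the barycenter and below the affine function interpolating its values at the
  vertices.
\<close>

section \<open>Distribution functions and affine interpolation\<close>

text \<open>A finite Borel measure on the line is determined by its distribution function, and each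
  integral is the mean of the push-forward measure.\<close>

lemma integral_eq_if_same_distribution:
  fixes f g :: "'a \<Rightarrow> real"
  assumes "finite_measure M"
    and [measurable]: "f \<in> borel_measurable M" "g \<in> borel_measurable M"
    and eq: "\<And>t. measure M {x \<in> space M. f x \<le> t} = measure M {x \<in> space M. g x \<le> t}"
  shows "integral\<^sup>L M f = integral\<^sup>L M g"
proof -
  interpret finite_measure M by fact
  have fin: "finite_borel_measure (distr M borel h)" if "h \<in> borel_measurable M" for h
    using that by (auto simp: finite_borel_measure_def finite_borel_measure_axioms_def
        intro: finite_measure_distr)
  have "cdf (distr M borel f) = cdf (distr M borel g)"
    using eq by (auto simp: fun_eq_iff cdf_def measure_distr vimage_def Int_def conj_commute)
  then have distr_eq: "distr M borel f = distr M borel g"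
    by (intro cdf_unique' fin assms(2,3))
  have "integral\<^sup>L M h = integral\<^sup>L (distr M borel h) (\<lambda>x. x)" if "h \<in> borel_measurable M"
    for h :: "'a \<Rightarrow> real"
    by (rule integral_distr[OF that, of "\<lambda>x. x", symmetric]) simp
  then show ?thesis
    using assms(2,3) distr_eq by metis
qed

text \<open>Translating one point \<open>a\<close> of \<open>B\<close> to the origin turns affine
  independence into linear independence, and a linear map can be prescribed freely on an independent
  set. The constant \<open>c\<close> then corrects the value at \<open>a\<close>.\<close>

lemma affine_extension:
  fixes g :: "'a::real_vector \<Rightarrow> 'b::real_vector"
  assumes "\<not> affine_dependent B"
  obtains L c where "linear L" "\<And>b. b \<in> B \<Longrightarrow> L b + c = g b"
proof (cases "B = {}")
  case True
  then show ?thesis using that[of "\<lambda>_. 0"] linear_zero by blast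
next
  case False
  then obtain a where a: "a \<in> B" by blast
  then have "independent ((\<lambda>x. - a + x) ` (B - {a}))"
    using assms affine_dependent_iff_dependent2 by blast
  then obtain L where L: "linear L"
    "\<forall>x\<in>(\<lambda>x. - a + x) ` (B - {a}). L x = g (a + x) - g a"
    using linear_independent_extend[of _ "\<lambda>x. g (a + x) - g a"] by blast
  have "L b + (g a - L a) = g b" if "b \<in> B" for b
  proof (cases "b = a")
    case False
    then have "L (- a + b) = g b - g a" using L(2) that by auto
    then show ?thesis by (simp only: linear_add[OF L(1)] linear_neg[OF L(1)]) (simp add: algebra_simps)
  qed simp
  then show ?thesis using that L(1) by blast
qed

lemma affine_combination:
  fixes L :: "'a::real_vector \<Rightarrow> real"
  assumes "linear L" "sum u B = 1"
  shows "L (\<Sum>b\<in>B. u b *\<^sub>R b) + c = (\<Sum>b\<in>B. u b * (L b + c))"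
  using assms by (simp add: linear_sum linear_cmul distrib_left sum.distrib flip: sum_distrib_right)

section \<open>Barycentric coordinates and the mean of an affine function over a simplex\<close>

text \<open>On the hull, \<open>L x + c\<close> is the barycentric coordinate of \<open>a\<close>.
  The homothety turns a coordinate value \<open>r\<close> into \<open>s * r + (1 - s)\<close>, which
  is at least \<open>1 - s\<close>. Conversely, if the weight of \<open>a\<close> is at least
  \<open>1 - s\<close>, that share can be split off and the rest rescaled to a preimage.\<close>

lemma simplex_sublevel_eq_homothety:
  fixes L :: "'a::real_vector \<Rightarrow> real"
  assumes "finite B" "a \<in> B" and L: "linear L"
    and coord: "\<And>b. b \<in> B \<Longrightarrow> L b + c = (if b = a then 1 else 0)"
    and s: "0 \<le> s" "s \<le> 1"
  shows "{x \<in> convex hull B. 1 - (L x + c) \<le> s} = (\<lambda>x. s *\<^sub>R x + (1 - s) *\<^sub>R a) ` (convex hull B)"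
proof -
  have co: "L (\<Sum>b\<in>B. u b *\<^sub>R b) + c = u a" if "sum u B = 1" for u
    using that assms(1,2) by (subst affine_combination[OF L]) (auto simp: coord if_distrib sum.delta' cong: if_cong)
  have a: "a \<in> convex hull B" using \<open>a \<in> B\<close> by (rule hull_inc)
  show ?thesis
  proof (intro equalityI subsetI)
    fix y assume "y \<in> {x \<in> convex hull B. 1 - (L x + c) \<le> s}"
    then obtain u where u: "\<forall>b\<in>B. 0 \<le> u b" "sum u B = 1" "(\<Sum>b\<in>B. u b *\<^sub>R b) = y" "1 - s \<le> u a"
      using co by (auto simp: convex_hull_finite[OF \<open>finite B\<close>])
    \<comment> \<open>The weights left after the share \<open>1 - s\<close> of \<open>a\<close> is
      removed; they are nonnegative with total \<open>s\<close>.\<close>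
    define w where "w b = u b - (if b = a then 1 - s else 0)" for b
    have w0: "\<forall>b\<in>B. 0 \<le> w b" using u by (auto simp: w_def)
    have ws: "sum w B = s" using u assms(1,2) by (simp add: w_def sum_subtractf sum.delta)
    have wy: "(\<Sum>b\<in>B. w b *\<^sub>R b) = y - (1 - s) *\<^sub>R a"
    proof -
      have "(\<Sum>b\<in>B. w b *\<^sub>R b) = (\<Sum>b\<in>B. u b *\<^sub>R b - (if b = a then (1 - s) *\<^sub>R a else 0))"
        by (rule sum.cong) (auto simp: w_def scaleR_left_diff_distrib)
      then show ?thesis using u assms(1,2) by (simp add: sum_subtractf sum.delta)
    qed
    show "y \<in> (\<lambda>x. s *\<^sub>R x + (1 - s) *\<^sub>R a) ` (convex hull B)"
    \<comment> \<open>Rescaling by \<open>1 / s\<close> fails for \<open>s = 0\<close>, where the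
      homothety collapses everything to \<open>a\<close>.\<close>
    proof (cases "s = 0")
      case True
      then have "\<forall>b\<in>B. w b = 0" using w0 ws sum_nonneg_eq_0_iff[OF \<open>finite B\<close>, of w] by auto
      then have "y = a" using wy True by simp
      then show ?thesis using True a by auto
    next
      case False
      have "(\<Sum>b\<in>B. (w b / s) *\<^sub>R b) \<in> convex hull B"
        unfolding convex_hull_finite[OF \<open>finite B\<close>]
        using w0 ws s False by (auto intro!: exI[of _ "\<lambda>b. w b / s"] simp flip: sum_divide_distrib)
      moreover have "s *\<^sub>R (\<Sum>b\<in>B. (w b / s) *\<^sub>R b) = y - (1 - s) *\<^sub>R a"
        using False wy by (simp add: scaleR_sum_right)
      ultimately show ?thesis by (intro image_eqI) auto
    qed
  next
    fix y assume "y \<in> (\<lambda>x. s *\<^sub>R x + (1 - s) *\<^sub>R a) ` (convex hull B)"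
    then obtain x where x: "x \<in> convex hull B" and y: "y = s *\<^sub>R x + (1 - s) *\<^sub>R a" by blast
    have "L x + c \<ge> 0" using x co by (auto simp: convex_hull_finite[OF \<open>finite B\<close>] \<open>a \<in> B\<close>)
    moreover have "L y + c = s * (L x + c) + (1 - s) * (L a + c)"
      unfolding y by (simp add: linear_add[OF L] linear_cmul[OF L]) (simp add: algebra_simps)
    ultimately have "1 - (L y + c) \<le> s" using coord[OF \<open>a \<in> B\<close>] s by simp
    moreover have "y \<in> convex hull B"
      unfolding y using x a s by (intro convexD[OF convex_convex_hull]) auto
    ultimately show "y \<in> {x \<in> convex hull B. 1 - (L x + c) \<le> s}" by simp
  qed
qed

text \<open>A homothety of ratio \<open>s\<close> scales volume by \<open>s ^ DIM('a)\<close>. What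
  matters later is that the right-hand side does not involve \<open>a\<close>, so all coordinates
  are equidistributed.\<close>

lemma measure_simplex_sublevel:
  fixes L :: "'a::euclidean_space \<Rightarrow> real"
  assumes "finite B" "a \<in> B" and L: "linear L"
    and coord: "\<And>b. b \<in> B \<Longrightarrow> L b + c = (if b = a then 1 else 0)"
  shows "measure lebesgue {x \<in> convex hull B. 1 - (L x + c) \<le> s} =
    (if s < 0 then 0 else min s 1 ^ DIM('a) * measure lebesgue (convex hull B))"
proof -
  have le1: "L x + c \<le> 1" and ge0: "L x + c \<ge> 0" if x: "x \<in> convex hull B" for x
  proof -
    obtain u where u: "\<forall>b\<in>B. 0 \<le> u b" "sum u B = 1" "(\<Sum>b\<in>B. u b *\<^sub>R b) = x"
      using x by (auto simp: convex_hull_finite[OF \<open>finite B\<close>])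
    have "L x + c = u a"
      unfolding u(3)[symmetric] using assms(1,2) u(2)
      by (subst affine_combination[OF L]) (auto simp: coord if_distrib sum.delta' cong: if_cong)
    then show "L x + c \<le> 1" "L x + c \<ge> 0"
      using u assms(1,2) member_le_sum[of a B u] by auto
  qed
  consider "s < 0" | "0 \<le> s" "s \<le> 1" | "1 < s" by linarith
  then show ?thesis
  proof cases
    case 1
    then have "{x \<in> convex hull B. 1 - (L x + c) \<le> s} = {}" using le1 by force
    then show ?thesis using 1 by (simp only: measure_empty) simp
  next
    case 2
    then show ?thesis
      using measure_lebesgue_affine[of s "(1 - s) *\<^sub>R a" "convex hull B"]
      by (subst simplex_sublevel_eq_homothety[OF assms 2]) auto
  next
    case 3
    then have "{x \<in> convex hull B. 1 - (L x + c) \<le> s} = convex hull B" using ge0 by force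
    then show ?thesis using 3 by simp
  qed
qed

text \<open>An affine function is the combination of the barycentric coordinates with its vertex
  values as coefficients, and every coordinate has the same integral.\<close>

lemma set_integral_affine_simplex:
  fixes L :: "'a::euclidean_space \<Rightarrow> real"
  assumes B: "\<not> affine_dependent B" "B \<noteq> {}" and L: "linear L"
  shows "(LINT x:convex hull B|lebesgue. L x + c) =
    measure lebesgue (convex hull B) * (L ((1 / card B) *\<^sub>R \<Sum>B) + c)"
proof -
  let ?S = "convex hull B"
  define M where "M = lebesgue_on ?S"
  have finB: "finite B" using B(1) by (rule aff_independent_finite)
  have cardB: "card B > 0" using finB B(2) by (simp add: card_gt_0_iff)
  have comp: "compact ?S" using finB by (simp add: finite_imp_compact_convex_hull)
  then have meas: "?S \<in> lmeasurable" by (rule lmeasurable_compact)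
  then have sets: "?S \<in> sets lebesgue" by auto
  have M: "finite_measure M" unfolding M_def using meas by (rule finite_measure_lebesgue_on)
  interpret finite_measure M by fact
  have spM: "space M = ?S" by (simp add: M_def space_restrict_space)
  have set_int: "(LINT x:?S|lebesgue. h x) = integral\<^sup>L M h" for h :: "'a \<Rightarrow> real"
    using sets by (simp add: M_def set_lebesgue_integral_def integral_restrict_space)
  have cont: "continuous_on ?S (\<lambda>x. K x + d)" if "linear K" for K :: "'a \<Rightarrow> real" and d
    using that by (intro continuous_intros linear_continuous_on) (simp add: linear_linear)
  have mb: "(\<lambda>x. K x + d) \<in> borel_measurable M" if "linear K" for K :: "'a \<Rightarrow> real" and d
    unfolding M_def using cont[OF that] sets by (rule continuous_imp_measurable_on_sets_lebesgue)
  have int: "integrable M (\<lambda>x. K x + d)" if K: "linear K" for K :: "'a \<Rightarrow> real" and d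
  proof -
    obtain e where "\<And>x. x \<in> ?S \<Longrightarrow> norm (K x + d) \<le> e"
      using compact_imp_bounded[OF compact_continuous_image[OF cont[OF K] comp], of d]
      by (auto simp: bounded_iff)
    then show ?thesis by (intro integrable_const_bound[of _ e] mb K AE_I2) (auto simp: spM)
  qed
  \<comment> \<open>The barycentric coordinate of each vertex, as an affine function on the whole
    space.\<close>
  have "\<exists>K d. linear K \<and> (\<forall>b\<in>B. K b + d = (if b = a then 1 else 0 :: real))" for a
    by (rule affine_extension[OF B(1), of "\<lambda>b. if b = a then 1 else 0"]) blast
  then obtain K d where K: "\<And>a. linear (K a)"
    and coord: "\<And>a b. b \<in> B \<Longrightarrow> K a b + d a = (if b = a then 1 else 0 :: real)"
    by metis
  define l where "l a x = K a x + d a" for a x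
  have l_int: "integrable M (l a)" for a unfolding l_def using K by (rule int)
  have interp: "J x + e = (\<Sum>a\<in>B. (J a + e) * l a x)" if J: "linear J" and x: "x \<in> ?S" for J e x
  proof -
    obtain u where u: "sum u B = 1" "(\<Sum>b\<in>B. u b *\<^sub>R b) = x"
      using x by (auto simp: convex_hull_finite[OF finB])
    have "l a x = u a" if "a \<in> B" for a
      unfolding l_def u(2)[symmetric] using finB that u(1)
      by (subst affine_combination[OF K]) (auto simp: coord if_distrib sum.delta' cong: if_cong)
    then show ?thesis
      unfolding u(2)[symmetric] affine_combination[OF J u(1)] by (simp add: mult.commute)
  qed
  have lmeas: "measure M {x \<in> space M. P x} = measure lebesgue {x \<in> ?S. P x}" for P
    unfolding spM unfolding M_def using sets by (intro measure_restrict_space) auto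
  have same: "integral\<^sup>L M (l a) = integral\<^sup>L M (l a')" if "a \<in> B" "a' \<in> B" for a a'
  proof -
    \<comment> \<open>Passing to \<open>1 - l a\<close> makes the sublevel sets the homothetic
      copies whose volumes are known.\<close>
    have "integral\<^sup>L M (\<lambda>x. 1 - l a x) = integral\<^sup>L M (\<lambda>x. 1 - l a' x)"
    proof (rule integral_eq_if_same_distribution[OF M])
      fix t
      show "measure M {x \<in> space M. 1 - l a x \<le> t} = measure M {x \<in> space M. 1 - l a' x \<le> t}"
        unfolding lmeas l_def using measure_simplex_sublevel[OF finB _ K coord] that by simp
    qed (intro borel_measurable_diff borel_measurable_const borel_measurable_integrable l_int)+
    then show ?thesis using l_int by simp
  qed
  have avg: "integral\<^sup>L M (l a) = measure lebesgue ?S / card B" if "a \<in> B" for a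
  proof -
    have "(\<Sum>a'\<in>B. integral\<^sup>L M (l a')) = integral\<^sup>L M (\<lambda>x. \<Sum>a'\<in>B. l a' x)"
      using l_int by simp
    also have "\<dots> = integral\<^sup>L M (\<lambda>x. 1)"
      \<comment> \<open>Interpolating the constant function 1 says that the coordinates sum to
        1.\<close>
      using interp[of "\<lambda>_. 0" _ 1] linear_zero by (intro Bochner_Integration.integral_cong) (auto simp: spM)
    also have "\<dots> = measure lebesgue ?S" using lmeas[of "\<lambda>_. True"] by simp
    finally have "card B * integral\<^sup>L M (l a) = measure lebesgue ?S"
      using sum.cong[of B B "\<lambda>a'. integral\<^sup>L M (l a')" "\<lambda>_. integral\<^sup>L M (l a)"] same[OF _ that]
      by simp
    then show ?thesis using cardB by (simp add: field_simps)
  qed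
  have "integral\<^sup>L M (\<lambda>x. L x + c) = integral\<^sup>L M (\<lambda>x. \<Sum>a\<in>B. (L a + c) * l a x)"
    using interp[OF L] by (intro Bochner_Integration.integral_cong) (auto simp: spM)
  also have "\<dots> = (\<Sum>a\<in>B. (L a + c) * integral\<^sup>L M (l a))"
    using l_int by simp
  also have "\<dots> = measure lebesgue ?S * (\<Sum>a\<in>B. (1 / card B) * (L a + c))"
    by (simp add: avg sum_distrib_left mult.commute)
  also have "(\<Sum>a\<in>B. (1 / card B) * (L a + c)) = L (\<Sum>a\<in>B. (1 / card B) *\<^sub>R a) + c"
    using cardB by (intro affine_combination[OF L, symmetric]) simp
  finally show ?thesis by (simp add: set_int scaleR_sum_right)
qed

section \<open>Supporting affine functions of convex functions\<close>

text \<open>A hyperplane separating the point over \<open>q\<close> from the strict epigraph is not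
  vertical because \<open>q\<close> is interior, so it is the graph of the required affine
  function.\<close>

lemma convex_on_supporting_affine:
  fixes f :: "'a::euclidean_space \<Rightarrow> real"
  assumes f: "convex_on S f" and q: "q \<in> interior S"
  obtains v where "\<And>x. x \<in> S \<Longrightarrow> f q + v \<bullet> (x - q) \<le> f x"
proof -
  have qS: "q \<in> S" using q interior_subset by blast
  \<comment> \<open>the strict epigraph of \<open>f\<close>, translated so that the point over \<open>q\<close> is the origin\<close>
  define E where "E = {(z, t). q + z \<in> S \<and> f (q + z) < f q + t}"
  have "convex E"
  proof (rule convexI)
    fix p1 p2 :: "'a \<times> real" and u v :: real
    assume p: "p1 \<in> E" "p2 \<in> E" and uv: "0 \<le> u" "0 \<le> v" "u + v = 1"
    obtain z1 t1 z2 t2 where z: "p1 = (z1, t1)" "p2 = (z2, t2)" by fastforce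
    let ?x1 = "q + z1" and ?x2 = "q + z2"
    have zE: "?x1 \<in> S" "?x2 \<in> S" "f ?x1 < f q + t1" "f ?x2 < f q + t2"
      using p by (auto simp: z E_def)
    have eq: "u *\<^sub>R ?x1 + v *\<^sub>R ?x2 = q + (u *\<^sub>R z1 + v *\<^sub>R z2)"
      using uv(3) by (simp add: algebra_simps flip: scaleR_left_distrib)
    have "f (u *\<^sub>R ?x1 + v *\<^sub>R ?x2) \<le> u * f ?x1 + v * f ?x2"
      using f zE uv by (auto simp: convex_on_def)
    also have "\<dots> < u * (f q + t1) + v * (f q + t2)"
    \<comment> \<open>For \<open>u > 0\<close> the first term carries the strictness; for
      \<open>u = 0\<close> one has \<open>v = 1\<close> and the second does.\<close>
    proof (cases "u = 0")
      case False
      then show ?thesis using zE uv by (intro add_less_le_mono mult_strict_left_mono mult_left_mono) auto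
    qed (use zE uv in auto)
    also have "\<dots> = f q + (u * t1 + v * t2)"
      using uv(3) by (simp add: algebra_simps) (metis distrib_right mult_1)
    finally have "f (q + (u *\<^sub>R z1 + v *\<^sub>R z2)) < f q + (u * t1 + v * t2)" by (simp add: eq)
    moreover have "q + (u *\<^sub>R z1 + v *\<^sub>R z2) \<in> S"
      unfolding eq[symmetric] using f zE uv by (intro convexD) (auto simp: convex_on_def)
    ultimately show "u *\<^sub>R p1 + v *\<^sub>R p2 \<in> E" by (simp add: z E_def)
  qed
  moreover have "0 \<notin> E" by (simp add: E_def zero_prod_def)
  ultimately obtain w where w: "w \<noteq> 0" "\<forall>y\<in>E. 0 \<le> w \<bullet> y"
    using separating_hyperplane_set_0 by blast
  obtain a b where ab: "w = (a, b)" by fastforce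
  have sep: "0 \<le> a \<bullet> z + b * t" if "q + z \<in> S" "f (q + z) < f q + t" for z t
    using w(2) that by (force simp: ab E_def)
  have "0 \<le> b" using sep[of 0 1] qS by simp
  \<comment> \<open>With \<open>b = 0\<close> the hyperplane would be vertical: a step of length
    \<open>e\<close> from \<open>q\<close> against \<open>a\<close> stays in \<open>S\<close> but
    makes the inner product with \<open>a\<close> negative.\<close>
  moreover have "b \<noteq> 0"
  proof
    assume b: "b = 0"
    then have "a \<noteq> 0" using w(1) ab by (auto simp: zero_prod_def)
    obtain e where e: "e > 0" "cball q e \<subseteq> S"
      using q by (auto simp: mem_interior_cball)
    let ?z = "(- (e / norm a)) *\<^sub>R a"
    have "q + ?z \<in> S" using e \<open>a \<noteq> 0\<close> by (intro subsetD[OF e(2)]) (simp add: dist_norm)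
    then have "0 \<le> a \<bullet> ?z" using sep[of ?z "f (q + ?z) - f q + 1"] b by simp
    moreover have "a \<bullet> ?z < 0" using e \<open>a \<noteq> 0\<close> by (simp add: divide_simps)
    ultimately show False by simp
  qed
  ultimately have b: "b > 0" by simp
  \<comment> \<open>the epigraph is strict, so the bound at height \<open>f x\<close> is obtained only in the limit\<close>
  have "f q + (- (1 / b) *\<^sub>R a) \<bullet> (x - q) \<le> f x" if "x \<in> S" for x
  proof (rule field_le_epsilon)
    fix e :: real assume "e > 0"
    then have "0 \<le> a \<bullet> (x - q) + b * (f x - f q + e)" using sep[of "x - q" "f x - f q + e"] that by simp
    then show "f q + (- (1 / b) *\<^sub>R a) \<bullet> (x - q) \<le> f x + e"
      using b by (simp add: field_simps)
  qed
  then show ?thesis using that by blast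
qed

section \<open>The two-sided inequality for positive functionals\<close>

lemma affine_functionsI:
  fixes L :: "'a::real_vector \<Rightarrow> real"
  assumes L: "linear L" and "convex S"
  shows "(\<lambda>x\<in>S. L x + c) \<in> affine_functions S"
  unfolding affine_functions_def affine_on_def
proof (intro CollectI conjI allI ballI impI)
  fix x y and u v :: real assume *: "x \<in> S" "y \<in> S" "0 \<le> u" "0 \<le> v" "u + v = 1"
  then have "u *\<^sub>R x + v *\<^sub>R y \<in> S" using \<open>convex S\<close> by (auto intro: convexD)
  moreover have "u * c + v * c = c" using * by (simp flip: distrib_right)
  ultimately show "(\<lambda>x\<in>S. L x + c) (u *\<^sub>R x + v *\<^sub>R y) =
      u * (\<lambda>x\<in>S. L x + c) x + v * (\<lambda>x\<in>S. L x + c) y"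
    using * by (simp add: linear_add[OF L] linear_cmul[OF L] distrib_left)
qed (use assms in auto)

lemma affine_functions_subset_convex_functions: "affine_functions S \<subseteq> convex_functions S"
  by (auto simp: affine_functions_def convex_functions_def affine_on_def convex_on_def)

theorem theorem2:
  fixes p :: "nat \<Rightarrow> real ^ 'n"
    and S :: "(real ^ 'n) set"
    and pbar :: "real ^ 'n"
    and X :: "((real ^ 'n) \<Rightarrow> real) set"
    and T :: "((real ^ 'n) \<Rightarrow> real) \<Rightarrow> real"
  assumes inj: "inj_on p {0..CARD('n)}"
    and indep: "\<not> affine_dependent (p ` {0..CARD('n)})"
    and S: "S = convex hull (p ` {0..CARD('n)})"
    and pbar: "pbar = (1 / (real CARD('n) + 1)) *\<^sub>R (\<Sum>i=0..CARD('n). p i)"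
    and dom: "fun_span S (convex_functions S) \<subseteq> X"
    and lin: "linear_functional_on S X T"
    and pos: "positive_functional_on S X T"
    and aff: "\<And>A. A \<in> affine_functions S \<Longrightarrow>
                T A = (1 / measure lebesgue S) * (LINT x:S|lebesgue. A x)"
  shows "\<forall>f \<in> convex_functions S.
           f pbar \<le> T f \<and> T f \<le> (1 / (real CARD('n) + 1)) * (\<Sum>i=0..CARD('n). f (p i))"
proof
  fix f assume "f \<in> convex_functions S"
  define B where "B = p ` {0..CARD('n)}"
  have cardB: "card B = Suc CARD('n)" unfolding B_def by (simp add: card_image[OF inj])
  have finB: "finite B" and B_ne: "B \<noteq> {}" by (auto simp: B_def)
  have B: "\<not> affine_dependent B" and SB: "S = convex hull B" using indep S by (simp_all add: B_def)
  have convS: "convex S" by (simp add: SB)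
  have sum_B: "(\<Sum>i=0..CARD('n). h (p i)) = sum h B" for h :: "_ \<Rightarrow> 'c::comm_monoid_add"
    unfolding B_def by (simp add: sum.reindex[OF inj])
  have pbar': "pbar = (1 / card B) *\<^sub>R \<Sum>B"
    unfolding pbar cardB sum_B[of "\<lambda>x. x"] by (simp add: add.commute)
  \<comment> \<open>With one vertex more than the dimension, interior points are those with all
    barycentric coordinates positive; at the barycenter they are all equal.\<close>
  have int: "pbar \<in> interior S"
    unfolding SB interior_convex_hull_explicit_minimal[OF B] pbar'
    using cardB by (auto intro!: exI[of _ "\<lambda>_. 1 / real (Suc CARD('n))"] simp: scaleR_sum_right)
  have "S \<in> lmeasurable"
    unfolding SB using finB by (intro lmeasurable_compact finite_imp_compact_convex_hull)
  moreover have "\<not> negligible S"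
    using int open_not_negligible[OF open_interior, of S] negligible_subset[OF _ interior_subset, of S] by auto
  ultimately have vol: "measure lebesgue S \<noteq> 0" using negligible_iff_measure0 by blast
  have T_aff: "T (\<lambda>x\<in>S. L x + c) = L pbar + c" if "linear L" for L c
  proof -
    \<comment> \<open>The restricted function agrees with \<open>L x + c\<close> on
      \<open>S\<close>, and the indicator in the set integral removes the rest.\<close>
    have "(LINT x:S|lebesgue. (\<lambda>x\<in>S. L x + c) x) = (LINT x:S|lebesgue. L x + c)"
      unfolding set_lebesgue_integral_def
      by (intro Bochner_Integration.integral_cong) (auto simp: indicator_def)
    then show ?thesis
      using aff[OF affine_functionsI[OF that convS, of c]] vol set_integral_affine_simplex[OF B B_ne that]
      by (simp add: SB pbar')
  qed
  have conv_X: "convex_functions S \<subseteq> X"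
    using hull_subset[of "convex_functions S" "fun_subspace S"] dom by (simp add: fun_span_def)
  have aff_X: "(\<lambda>x\<in>S. L x + c) \<in> X" if "linear L" for L c
    using affine_functionsI[OF that convS] affine_functions_subset_convex_functions conv_X by blast
  have fX: "f \<in> X" and f: "convex_on S f"
    using \<open>f \<in> convex_functions S\<close> conv_X by (auto simp: convex_functions_def)
  have mono: "T g \<le> T h" if "g \<in> X" "h \<in> X" "\<And>x. x \<in> S \<Longrightarrow> g x \<le> h x" for g h
    using pos that by (auto simp: positive_functional_on_def)
  obtain v where v: "\<And>x. x \<in> S \<Longrightarrow> f pbar + v \<bullet> (x - pbar) \<le> f x"
    using convex_on_supporting_affine[OF f int] by blast
  have lin_v: "linear ((\<bullet>) v)" by (simp add: bounded_linear.linear bounded_linear_inner_right)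
  \<comment> \<open>The supporting affine function takes the value \<open>f pbar\<close> at
    \<open>pbar\<close>, which is where \<open>T\<close> evaluates it.\<close>
  have "f pbar = T (\<lambda>x\<in>S. v \<bullet> x + (f pbar - v \<bullet> pbar))"
    by (simp add: T_aff[OF lin_v])
  also have "\<dots> \<le> T f"
  proof (intro mono aff_X lin_v fX)
    fix x assume "x \<in> S"
    then show "(\<lambda>x\<in>S. v \<bullet> x + (f pbar - v \<bullet> pbar)) x \<le> f x"
      using v[OF \<open>x \<in> S\<close>] by (simp add: inner_diff_right)
  qed
  finally have lower: "f pbar \<le> T f" .
  obtain L c where L: "linear L" and Lc: "\<And>b. b \<in> B \<Longrightarrow> L b + c = f b"
    using affine_extension[OF B, of f] by blast
  have Lsum: "L (\<Sum>b\<in>B. u b *\<^sub>R b) + c = (\<Sum>b\<in>B. u b * f b)" if "sum u B = 1" for u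
    using affine_combination[OF L that] Lc by simp
  have "T f \<le> T (\<lambda>x\<in>S. L x + c)"
  proof (intro mono aff_X L fX)
    fix x assume "x \<in> S"
    then obtain u where u: "\<forall>b\<in>B. 0 \<le> u b" "sum u B = 1" "(\<Sum>b\<in>B. u b *\<^sub>R b) = x"
      by (auto simp: SB convex_hull_finite[OF finB])
    \<comment> \<open>Jensen's inequality at the vertices; the right-hand side is the interpolating
      affine function at \<open>x\<close>.\<close>
    have "f x \<le> (\<Sum>b\<in>B. u b * f b)"
      using convex_on_sum[OF finB B_ne f u(2), of "\<lambda>b. b"] u by (simp add: SB hull_inc)
    then show "f x \<le> (\<lambda>x\<in>S. L x + c) x" using Lsum[OF u(2)] u(3) \<open>x \<in> S\<close> by simp
  qed
  also have "\<dots> = L (\<Sum>b\<in>B. (1 / card B) *\<^sub>R b) + c"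
    by (simp add: T_aff[OF L] pbar' scaleR_sum_right)
  also have "\<dots> = (\<Sum>b\<in>B. (1 / card B) * f b)"
    using cardB by (intro Lsum) simp
  also have "\<dots> = (1 / (real CARD('n) + 1)) * (\<Sum>i=0..CARD('n). f (p i))"
    by (simp add: sum_B cardB add.commute sum_divide_distrib)
  finally show "f pbar \<le> T f \<and> T f \<le> (1 / (real CARD('n) + 1)) * (\<Sum>i=0..CARD('n). f (p i))"
    using lower by simp
qed

end
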